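(* Let $\mathbb{K}$ be a field of characteristic different from $2$, let $T$ be an $\mathcal{O}$-operator on a Hom-associative algebra $(A,\mu,\alpha)$ over $\mathbb{K}$ with respect to a bimodule $(M,l,r,\phi)$, and let $T_t=T+\sum_{i=1}^nt^iT_i$ be an order $n$ deformation of $T$. Then $T_t$ extends to a deformation of order $n+1$ if and only if its obstruction class $[\Theta_T]\in H^2(M,A)$ is trivial.
   Context: A Hom-associative algebra $(A,\mu,\alpha)$ (always multiplicative) is a vector space $A$ with a bilinear map $\mu$, written $\mu(a,b)=a\cdot b$, and a linear map $\alpha:A\to A$ such that $\alpha(a\cdot b)=\alpha(a)\cdot\alpha(b)$ and $\alpha(a)\cdot(b\cdot c)=(a\cdot b)\cdot\alpha(c)$ for all $a,b,c\in A$. A bimodule (representation) $(M,l,r,\phi)$ over $(A,\mu,\alpha)$ is a vector space $M$ with linear maps $\phi:M\to M$, $l:A\otimes M\to M$, $r:M\otimes A\to M$ such that for all $x,y\in A$, $v\in M$: $\phi l(x,v)=l(\alpha(x),\phi(v))$, $\phi r(v,x)=r(\phi(v),\alpha(x))$, $l(x\cdot y,\phi(v))=l(\alpha(x),l(y,v))$, $r(\phi(v),x\cdot y)=r(r(v,x),\alpha(y))$, $l(\alpha(x),r(v,y))=r(l(x,v),\alpha(y))$. Write $xv=l(x,v)$, $vx=r(v,x)$. An $\mathcal{O}$-operator on $A$ with respect to $M$ is a linear map $T:M\to A$ with $T\phi=\alpha T$ and $T(u)\cdot T(v)=T(T(u)v+uT(v))$ for all $u,v\in M$. $C^n_{\phi,\alpha}(M,A)$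 ($n\ge1$) is the space of linear maps $f:M^{\otimes n}\to A$ with $\alpha\circ f=f\circ\phi^{\otimes n}$. The differential $d_H:C^n_{\phi,\alpha}(M,A)\to C^{n+1}_{\phi,\alpha}(M,A)$ is $$(d_Hf)(u_1,\dots,u_{n+1})=T(\phi^{n-1}(u_1))\cdot f(u_2,\dots,u_{n+1})-T(\phi^{n-1}(u_1)f(u_2,\dots,u_{n+1}))$$ $$+\sum_{i=1}^n(-1)^if(\phi(u_1),\dots,\phi(u_{i-1}),u_iT(u_{i+1})+T(u_i)u_{i+1},\phi(u_{i+2}),\dots,\phi(u_{n+1}))$$ $$+(-1)^{n+1}f(u_1,\dots,u_n)\cdot T(\phi^{n-1}(u_{n+1}))-(-1)^{n+1}T(f(u_1,\dots,u_n)\phi^{n-1}(u_{n+1})),$$ and $H^2(M,A)=\ker(d_H|_{C^2_{\phi,\alpha}})/d_H(C^1_{\phi,\alpha}(M,A))$. For $S,S'\in C^1_{\phi,\alpha}(M,A)$, $\llbracket S,S'\rrbracket_\alpha\in C^2_{\phi,\alpha}(M,A)$ is $\llbracket S,S'\rrbracket_\alpha(u,v)=S(S'(u)v)+S(uS'(v))+S'(S(u)v)+S'(uS(v))-S(u)\cdot S'(v)-S'(u)\cdot S(v)$. An order $n$ deformation of $T$ ($n\ge1$) is $T_t=T+\sum_{i=1}^nt^iT_i$ with $T_i\in C^1_{\phi,\alpha}(M,A)$ such that, with $T_0=T$, $\sum_{i+j=k}T_i(u)\cdot T_j(v)=\sum_{i+j=k}T_i(T_j(u)v+uT_j(v))$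 for all $u,v\in M$ and $k=0,1,\dots,n$. It extends to a deformation of order $n+1$ if there is $T_{n+1}\in C^1_{\phi,\alpha}(M,A)$ such that $T_t+t^{n+1}T_{n+1}$ is an order $n+1$ deformation of $T$. Its obstruction cochain is $\Theta_T=-\frac12\sum_{i+j=n+1,\ i,j>0}\llbracket T_i,T_j\rrbracket_\alpha\in C^2_{\phi,\alpha}(M,A)$, which is a $2$-cocycle; its class $[\Theta_T]\in H^2(M,A)$ is the obstruction class. *)

theory Defs
  imports Complex_Main
begin

(* Vector spaces over 'k are whole types 'a, 'm with a scalar multiplication; linear maps on a
   tensor product are given as multilinear maps. *)

definition bilinear_map ::
    "('k::field \<Rightarrow> 'a::ab_group_add \<Rightarrow> 'a) \<Rightarrow> ('k \<Rightarrow> 'b::ab_group_add \<Rightarrow> 'b) \<Rightarrow>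
     ('k \<Rightarrow> 'c::ab_group_add \<Rightarrow> 'c) \<Rightarrow> ('a \<Rightarrow> 'b \<Rightarrow> 'c) \<Rightarrow> bool" where
  "bilinear_map s1 s2 s3 f \<longleftrightarrow>
     (\<forall>x. Vector_Spaces.linear s2 s3 (\<lambda>y. f x y)) \<and>
     (\<forall>y. Vector_Spaces.linear s1 s3 (\<lambda>x. f x y))"

locale hom_associative_algebra = vector_space scaleA
  for scaleA :: "'k::field \<Rightarrow> 'a::ab_group_add \<Rightarrow> 'a" +
  fixes mult :: "'a \<Rightarrow> 'a \<Rightarrow> 'a" (infixl "\<cdot>" 70)
    and \<alpha> :: "'a \<Rightarrow> 'a"
  assumes mult_bilinear: "bilinear_map scaleA scaleA scaleA (\<cdot>)"
    and alpha_linear: "Vector_Spaces.linear scaleA scaleA \<alpha>"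
    and alpha_mult: "\<alpha> (a \<cdot> b) = \<alpha> a \<cdot> \<alpha> b"
    and hom_assoc: "\<alpha> a \<cdot> (b \<cdot> c) = (a \<cdot> b) \<cdot> \<alpha> c"

locale hom_bimodule =
  hom_associative_algebra scaleA mult \<alpha> + M: vector_space scaleM
  for scaleA :: "'k::field \<Rightarrow> 'a::ab_group_add \<Rightarrow> 'a"
    and mult :: "'a \<Rightarrow> 'a \<Rightarrow> 'a" (infixl "\<cdot>" 70)
    and \<alpha> :: "'a \<Rightarrow> 'a"
    and scaleM :: "'k \<Rightarrow> 'm::ab_group_add \<Rightarrow> 'm" +
  fixes l :: "'a \<Rightarrow> 'm \<Rightarrow> 'm"
    and r :: "'m \<Rightarrow> 'a \<Rightarrow> 'm"
    and \<phi> :: "'m \<Rightarrow> 'm"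
  assumes phi_linear: "Vector_Spaces.linear scaleM scaleM \<phi>"
    and l_bilinear: "bilinear_map scaleA scaleM scaleM l"
    and r_bilinear: "bilinear_map scaleM scaleA scaleM r"
    and phi_l: "\<phi> (l x v) = l (\<alpha> x) (\<phi> v)"
    and phi_r: "\<phi> (r v x) = r (\<phi> v) (\<alpha> x)"
    and l_mult: "l (x \<cdot> y) (\<phi> v) = l (\<alpha> x) (l y v)"
    and r_mult: "r (\<phi> v) (x \<cdot> y) = r (r v x) (\<alpha> y)"
    and l_r: "l (\<alpha> x) (r v y) = r (l x v) (\<alpha> y)"

locale O_operator =
  hom_bimodule scaleA mult \<alpha> scaleM l r \<phi>
  for scaleA :: "'k::field \<Rightarrow> 'a::ab_group_add \<Rightarrow> 'a"
    and mult :: "'a \<Rightarrow> 'a \<Rightarrow> 'a" (infixl "\<cdot>" 70)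
    and \<alpha> :: "'a \<Rightarrow> 'a"
    and scaleM :: "'k \<Rightarrow> 'm::ab_group_add \<Rightarrow> 'm"
    and l :: "'a \<Rightarrow> 'm \<Rightarrow> 'm"
    and r :: "'m \<Rightarrow> 'a \<Rightarrow> 'm"
    and \<phi> :: "'m \<Rightarrow> 'm" +
  fixes T :: "'m \<Rightarrow> 'a"
  assumes T_linear: "Vector_Spaces.linear scaleM scaleA T"
    and T_phi: "T (\<phi> u) = \<alpha> (T u)"
    and T_mult: "T u \<cdot> T v = T (l (T u) v + r u (T v))"
begin

(* C^n: f takes the argument tuple (u_1, ..., u_n) as a list. The value 0 on lists of any other
   length is a normalisation, so that equal cochains are equal functions. *)
definition cochains :: "nat \<Rightarrow> ('m list \<Rightarrow> 'a) set" where
  "cochains n = {f.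
     (\<forall>us. length us \<noteq> n \<longrightarrow> f us = 0) \<and>
     (\<forall>us i. length us = n \<longrightarrow> i < n \<longrightarrow>
        Vector_Spaces.linear scaleM scaleA (\<lambda>u. f (us[i := u]))) \<and>
     (\<forall>us. length us = n \<longrightarrow> \<alpha> (f us) = f (map \<phi> us))}"

(* d_H on C^n, for n >= 1. The mathematical u_i is us ! (i - 1). *)
definition d_H :: "nat \<Rightarrow> ('m list \<Rightarrow> 'a) \<Rightarrow> 'm list \<Rightarrow> 'a" where
  "d_H n f us =
     (if length us = n + 1 then
        T ((\<phi> ^^ (n - 1)) (hd us)) \<cdot> f (tl us)
        - T (r ((\<phi> ^^ (n - 1)) (hd us)) (f (tl us)))
        + (\<Sum>i = 1..n. scaleA ((-1) ^ i)
             (f (map \<phi> (take (i - 1) us)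
                 @ [r (us ! (i - 1)) (T (us ! i)) + l (T (us ! (i - 1))) (us ! i)]
                 @ map \<phi> (drop (i + 1) us))))
        + scaleA ((-1) ^ (n + 1)) (f (butlast us) \<cdot> T ((\<phi> ^^ (n - 1)) (last us)))
        - scaleA ((-1) ^ (n + 1)) (T (l (f (butlast us)) ((\<phi> ^^ (n - 1)) (last us))))
      else 0)"

definition cocycles :: "nat \<Rightarrow> ('m list \<Rightarrow> 'a) set" where
  "cocycles n = {f \<in> cochains n. d_H n f = (\<lambda>_. 0)}"

definition coboundaries :: "nat \<Rightarrow> ('m list \<Rightarrow> 'a) set" where
  "coboundaries n = d_H (n - 1) ` cochains (n - 1)"

definition cohomologous :: "nat \<Rightarrow> (('m list \<Rightarrow> 'a) \<times> ('m list \<Rightarrow> 'a)) set" where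
  "cohomologous n =
     {(f, g). f \<in> cocycles n \<and> g \<in> cocycles n \<and> (\<lambda>us. f us - g us) \<in> coboundaries n}"

(* The elements of H^n = cocycles n // cohomologous n, for n >= 2. *)
definition cohomology_class :: "nat \<Rightarrow> ('m list \<Rightarrow> 'a) \<Rightarrow> ('m list \<Rightarrow> 'a) set" where
  "cohomology_class n f = cohomologous n `` {f}"

definition trivial_class :: "nat \<Rightarrow> ('m list \<Rightarrow> 'a) set \<Rightarrow> bool" where
  "trivial_class n c \<longleftrightarrow> c = cohomology_class n (\<lambda>_. 0)"

definition bracket :: "('m list \<Rightarrow> 'a) \<Rightarrow> ('m list \<Rightarrow> 'a) \<Rightarrow> 'm list \<Rightarrow> 'a" where
  "bracket S S' us = (case us of
     [u, v] \<Rightarrow>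
       S [l (S' [u]) v] + S [r u (S' [v])] + S' [l (S [u]) v] + S' [r u (S [v])]
       - S [u] \<cdot> S' [v] - S' [u] \<cdot> S [v]
   | _ \<Rightarrow> 0)"

definition T_cochain :: "'m list \<Rightarrow> 'a" where
  "T_cochain us = (case us of [u] \<Rightarrow> T u | _ \<Rightarrow> 0)"

(* Ts i is the coefficient of t^i; the values Ts i for i > n are irrelevant. *)
definition deformation :: "nat \<Rightarrow> (nat \<Rightarrow> 'm list \<Rightarrow> 'a) \<Rightarrow> bool" where
  "deformation n Ts \<longleftrightarrow>
     Ts 0 = T_cochain \<and>
     (\<forall>i\<in>{1..n}. Ts i \<in> cochains 1) \<and>
     (\<forall>k\<le>n. \<forall>u v.
        (\<Sum>i\<le>k. Ts i [u] \<cdot> Ts (k - i) [v]) =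
        (\<Sum>i\<le>k. Ts i [l (Ts (k - i) [u]) v + r u (Ts (k - i) [v])]))"

definition extends :: "nat \<Rightarrow> (nat \<Rightarrow> 'm list \<Rightarrow> 'a) \<Rightarrow> bool" where
  "extends n Ts \<longleftrightarrow> (\<exists>S \<in> cochains 1. deformation (n + 1) (Ts(n + 1 := S)))"

definition obstruction :: "nat \<Rightarrow> (nat \<Rightarrow> 'm list \<Rightarrow> 'a) \<Rightarrow> 'm list \<Rightarrow> 'a" where
  "obstruction n Ts us = scaleA (- (1 / 2)) (\<Sum>i = 1..n. bracket (Ts i) (Ts (n + 1 - i)) us)"

definition obstruction_class :: "nat \<Rightarrow> (nat \<Rightarrow> 'm list \<Rightarrow> 'a) \<Rightarrow> ('m list \<Rightarrow> 'a) set" where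
  "obstruction_class n Ts = cohomology_class 2 (obstruction n Ts)"

end

end

theory Submission
  imports Defs
begin

text \<open>
  Write \<open>u * v = u T(v) + T(u) v\<close> on \<open>M\<close>. Since \<open>T\<close> is an \<open>\<O>\<close>-operator, \<open>(M, *, \<phi>)\<close> is again a
  Hom-associative algebra (\<open>star_hom_assoc\<close>), and \<open>A\<close> is a bimodule over it under
  \<open>u \<rhd> a = T(u) \<cdot> a - T(u a)\<close> and \<open>a \<lhd> u = a \<cdot> T(u) - T(a u)\<close> (\<open>lact_lact\<close>, \<open>ract_ract\<close>,
  \<open>lact_ract\<close>). The differential \<open>d\<^sub>H\<close> is the Hom-Hochschild differential of this bimodule, and so
  its square vanishes; the case of \<open>1\<close>-cochains is \<open>d_H_d_H_1\<close>.

  Suppose that \<open>T\<^sub>t\<close> satisfies the deformation equations up to order \<open>n\<close>. Adding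
  \<open>t\<^sup>n\<^sup>+\<^sup>1 S\<close> leaves these untouched, so it gives an extension iff the equation in degree
  \<open>n + 1\<close> holds. In that equation the terms with index pairs \<open>(0, n + 1)\<close> and \<open>(n + 1, 0)\<close> form
  \<open>d\<^sub>H S\<close>. The others pair up under \<open>i \<leftrightarrow> n + 1 - i\<close>, each pair being a bracket
  up to sign, and because \<open>2\<close> is invertible they amount to \<open>\<Theta>\<^sub>T\<close> (\<open>obstruction_eq\<close>). The equation
  is therefore \<open>d\<^sub>H S + \<Theta>\<^sub>T = 0\<close> (\<open>deformation_Suc_iff\<close>).

  Hence \<open>T\<^sub>t\<close> extends iff \<open>\<Theta>\<^sub>T\<close> is a coboundary. As \<open>d\<^sub>H d\<^sub>H = 0\<close> on \<open>1\<close>-cochains, any coboundary of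
  degree \<open>2\<close> is a cocycle, and so being a coboundary is the same as having trivial class
  (\<open>trivial_class_2_iff\<close>).
\<close>

section \<open>Linear algebra\<close>

lemma linearD:
  assumes "Vector_Spaces.linear s1 s2 f"
  shows "f (x + y) = f x + f y" "f (x - y) = f x - f y" "f (- x) = - f x" "f 0 = 0"
    "f (s1 c x) = s2 c (f x)"
proof -
  interpret Vector_Spaces.linear s1 s2 f by (fact assms)
  show "f (x + y) = f x + f y" "f (x - y) = f x - f y" "f (- x) = - f x" "f 0 = 0"
    "f (s1 c x) = s2 c (f x)"
    by (fact add diff neg zero scale)+
qed

lemma bilinear_mapD:
  assumes "bilinear_map s1 s2 s3 f"
  shows "f (x + x') y = f x y + f x' y" "f (x - x') y = f x y - f x' y"
    "f 0 y = 0" "f (s1 c x) y = s3 c (f x y)"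
    "f x (y + y') = f x y + f x y'" "f x (y - y') = f x y - f x y'"
    "f x 0 = 0" "f x (s2 c y) = s3 c (f x y)"
  using assms linearD[of s1 s3 "\<lambda>x. f x y"] linearD[of s2 s3 "f x"]
  unfolding bilinear_map_def by auto

lemma two_neq_zero_if_CHAR_neq_2:
  assumes "CHAR('k::field) \<noteq> 2"
  shows "(2::'k) \<noteq> 0"
proof
  assume "(2::'k) = 0"
  then have "CHAR('k) dvd 2"
    using of_nat_eq_0_iff_char_dvd[of 2, where 'a = 'k] by simp
  then have "CHAR('k) = 1 \<or> CHAR('k) = 2"
    by (metis dvd_imp_le le_neq_implies_less less_2_cases not_less_eq
        One_nat_def dvd_0_left_iff zero_less_numeral zero_neq_numeral)
  then show False
    using assms CHAR_not_1[where 'a = 'k] by simp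
qed

context O_operator
begin

lemmas A_mult_simps = bilinear_mapD[OF mult_bilinear]
lemmas l_simps = bilinear_mapD[OF l_bilinear]
lemmas r_simps = bilinear_mapD[OF r_bilinear]
lemmas alpha_simps = linearD[OF alpha_linear]
lemmas phi_simps = linearD[OF phi_linear]
lemmas T_simps = linearD[OF T_linear]

lemmas structure_simps = A_mult_simps l_simps r_simps alpha_simps phi_simps T_simps

section \<open>The Hom-associative algebra on M and its bimodule A\<close>

definition star :: "'m \<Rightarrow> 'm \<Rightarrow> 'm" where
  "star u v = r u (T v) + l (T u) v"

definition lact :: "'m \<Rightarrow> 'a \<Rightarrow> 'a" where
  "lact u a = T u \<cdot> a - T (r u a)"

definition ract :: "'a \<Rightarrow> 'm \<Rightarrow> 'a" where
  "ract a u = a \<cdot> T u - T (l a u)"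

lemma T_star: "T (star u v) = T u \<cdot> T v"
  by (simp add: star_def T_mult add.commute)

lemma phi_star: "\<phi> (star u v) = star (\<phi> u) (\<phi> v)"
  by (simp add: star_def phi_simps phi_l phi_r T_phi)

lemma star_hom_assoc: "star (\<phi> u) (star v w) = star (star u v) (\<phi> w)"
proof -
  have "star (\<phi> u) (star v w) =
      r (r u (T v)) (\<alpha> (T w)) + (l (\<alpha> (T u)) (r v (T w)) + l (\<alpha> (T u)) (l (T v) w))"
    unfolding star_def[of "\<phi> u"] T_star by (simp add: star_def T_phi r_mult l_simps)
  also have "\<dots> = star (star u v) (\<phi> w)"
    unfolding star_def[of "star u v"] T_star
    by (simp add: star_def T_phi l_mult l_r r_simps)
  finally show ?thesis .
qed

lemma star_simps:
  "star (u + u') v = star u v + star u' v" "star (scaleM c u) v = scaleM c (star u v)"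
  "star u (v + v') = star u v + star u v'" "star u (scaleM c v) = scaleM c (star u v)"
  by (simp_all add: star_def structure_simps M.scale_right_distrib)

lemma lact_simps:
  "lact (u + u') a = lact u a + lact u' a" "lact (scaleM c u) a = scaleA c (lact u a)"
  "lact u (a + b) = lact u a + lact u b" "lact u (a - b) = lact u a - lact u b"
  "lact u (scaleA c a) = scaleA c (lact u a)" "lact u 0 = 0"
  by (simp_all add: lact_def structure_simps scale_right_diff_distrib)

lemma ract_simps:
  "ract (a + b) u = ract a u + ract b u" "ract (a - b) u = ract a u - ract b u"
  "ract (scaleA c a) u = scaleA c (ract a u)" "ract 0 u = 0"
  "ract a (u + u') = ract a u + ract a u'" "ract a (scaleM c u) = scaleA c (ract a u)"
  by (simp_all add: ract_def structure_simps scale_right_diff_distrib)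

lemma alpha_lact: "\<alpha> (lact u a) = lact (\<phi> u) (\<alpha> a)"
  by (simp add: lact_def alpha_simps alpha_mult T_phi[symmetric] phi_r)

lemma alpha_ract: "\<alpha> (ract a u) = ract (\<alpha> a) (\<phi> u)"
  by (simp add: ract_def alpha_simps alpha_mult T_phi[symmetric] phi_l)

text \<open>In each of the three module laws the \<open>\<O>\<close>-operator identity turns a product
  \<open>T(u) \<cdot> T(v)\<close> into two values of \<open>T\<close>, one of which cancels the term with nested \<open>T\<close>. The rest is
  Hom-associativity of \<open>A\<close> and the bimodule axioms of \<open>M\<close>.\<close>

lemma lact_lact: "lact (\<phi> u) (lact v a) = lact (star u v) (\<alpha> a)"
proof -
  have "lact (\<phi> u) (lact v a) = \<alpha> (T u) \<cdot> (T v \<cdot> a) - T (\<phi> u) \<cdot> T (r v a)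
      - (T (r (\<phi> u) (T v \<cdot> a)) - T (r (\<phi> u) (T (r v a))))"
    by (simp add: lact_def structure_simps T_phi)
  also have "T (\<phi> u) \<cdot> T (r v a) = T (l (\<alpha> (T u)) (r v a)) + T (r (\<phi> u) (T (r v a)))"
    by (simp only: T_mult T_simps) (simp add: T_phi)
  also have "\<alpha> (T u) \<cdot> (T v \<cdot> a) - (T (l (\<alpha> (T u)) (r v a)) + T (r (\<phi> u) (T (r v a))))
      - (T (r (\<phi> u) (T v \<cdot> a)) - T (r (\<phi> u) (T (r v a))))
      = (T u \<cdot> T v) \<cdot> \<alpha> a - T (r (l (T u) v) (\<alpha> a)) - T (r (r u (T v)) (\<alpha> a))"
    by (simp add: hom_assoc l_r r_mult)
  also have "\<dots> = lact (star u v) (\<alpha> a)"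
    unfolding lact_def T_star by (simp add: star_def structure_simps)
  finally show ?thesis .
qed

lemma ract_ract: "ract (ract a u) (\<phi> v) = ract (\<alpha> a) (star u v)"
proof -
  have "ract (ract a u) (\<phi> v) = (a \<cdot> T u) \<cdot> \<alpha> (T v) - T (l a u) \<cdot> T (\<phi> v)
      - (T (l (a \<cdot> T u) (\<phi> v)) - T (l (T (l a u)) (\<phi> v)))"
    by (simp add: ract_def structure_simps T_phi)
  also have "T (l a u) \<cdot> T (\<phi> v) = T (l (T (l a u)) (\<phi> v)) + T (r (l a u) (\<alpha> (T v)))"
    by (simp only: T_mult T_simps) (simp add: T_phi)
  also have "(a \<cdot> T u) \<cdot> \<alpha> (T v) - (T (l (T (l a u)) (\<phi> v)) + T (r (l a u) (\<alpha> (T v))))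
      - (T (l (a \<cdot> T u) (\<phi> v)) - T (l (T (l a u)) (\<phi> v)))
      = \<alpha> a \<cdot> (T u \<cdot> T v) - T (l (\<alpha> a) (r u (T v))) - T (l (\<alpha> a) (l (T u) v))"
    by (simp add: hom_assoc l_r l_mult)
  also have "\<dots> = ract (\<alpha> a) (star u v)"
    unfolding ract_def T_star by (simp add: star_def structure_simps)
  finally show ?thesis .
qed

lemma lact_ract: "lact (\<phi> u) (ract a v) = ract (lact u a) (\<phi> v)"
proof -
  have "lact (\<phi> u) (ract a v) = \<alpha> (T u) \<cdot> (a \<cdot> T v) - T (\<phi> u) \<cdot> T (l a v)
      - (T (r (\<phi> u) (a \<cdot> T v)) - T (r (\<phi> u) (T (l a v))))"
    by (simp add: lact_def ract_def structure_simps T_phi)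
  also have "T (\<phi> u) \<cdot> T (l a v) = T (l (\<alpha> (T u)) (l a v)) + T (r (\<phi> u) (T (l a v)))"
    by (simp only: T_mult T_simps) (simp add: T_phi)
  also have "\<alpha> (T u) \<cdot> (a \<cdot> T v) - (T (l (\<alpha> (T u)) (l a v)) + T (r (\<phi> u) (T (l a v))))
      - (T (r (\<phi> u) (a \<cdot> T v)) - T (r (\<phi> u) (T (l a v))))
      = (T u \<cdot> a) \<cdot> \<alpha> (T v) - T (l (T u \<cdot> a) (\<phi> v)) - T (r (r u a) (\<alpha> (T v)))"
    by (simp add: hom_assoc l_mult r_mult)
  also have "\<dots> = (T u \<cdot> a) \<cdot> \<alpha> (T v) - T (r u a) \<cdot> T (\<phi> v)
      - (T (l (T u \<cdot> a) (\<phi> v)) - T (l (T (r u a)) (\<phi> v)))"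
    by (simp only: T_mult T_simps) (simp add: T_phi)
  also have "\<dots> = ract (lact u a) (\<phi> v)"
    by (simp add: lact_def ract_def structure_simps T_phi)
  finally show ?thesis .
qed

section \<open>The complex in low degrees\<close>

lemma cochains_1D:
  assumes "f \<in> cochains 1"
  shows "f [u + v] = f [u] + f [v]" "f [scaleM c u] = scaleA c (f [u])" "\<alpha> (f [u]) = f [\<phi> u]"
proof -
  have lin: "\<And>us i. length us = 1 \<Longrightarrow> i < 1 \<Longrightarrow>
      Vector_Spaces.linear scaleM scaleA (\<lambda>u. f (us[i := u]))"
    and equi: "\<And>us. length us = 1 \<Longrightarrow> \<alpha> (f us) = f (map \<phi> us)"
    using assms unfolding cochains_def mem_Collect_eq by blast+
  have "Vector_Spaces.linear scaleM scaleA (\<lambda>u. f [u])"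
    using lin[of "[0]" 0] by simp
  then show "f [u + v] = f [u] + f [v]" "f [scaleM c u] = scaleA c (f [u])"
    by (rule linearD)+
  show "\<alpha> (f [u]) = f [\<phi> u]" using equi[of "[u]"] by simp
qed

lemma zero_in_cochains: "(\<lambda>_. 0) \<in> cochains n"
  unfolding cochains_def
  by (auto simp: alpha_simps Vector_Spaces.linear_iff vector_space_axioms M.vector_space_axioms)

lemma cochains_diff:
  assumes "f \<in> cochains n" "g \<in> cochains n"
  shows "(\<lambda>us. f us - g us) \<in> cochains n"
  using assms unfolding cochains_def
  by (auto simp: alpha_simps Vector_Spaces.linear_iff scale_right_diff_distrib)

lemma d_H_diff: "d_H n (\<lambda>us. f us - g us) = (\<lambda>us. d_H n f us - d_H n g us)"
  unfolding d_H_def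
  by (rule ext) (simp add: structure_simps scale_right_diff_distrib sum_subtractf algebra_simps)

lemma d_H_zero: "d_H n (\<lambda>_. 0) = (\<lambda>_. 0)"
  unfolding d_H_def by (rule ext) (simp add: structure_simps)

lemma d_H_1: "d_H 1 f [u, v] = lact u (f [v]) - f [star u v] + ract (f [u]) v"
  by (simp add: d_H_def lact_def ract_def star_def)

lemma d_H_2:
  "d_H 2 g [u, v, w] =
     lact (\<phi> u) (g [v, w]) - g [star u v, \<phi> w] + g [\<phi> u, star v w] - ract (g [u, v]) (\<phi> w)"
proof -
  have "{1..2::nat} = {1, 2}" by auto
  then show ?thesis
    by (simp add: d_H_def lact_def ract_def star_def)
qed

lemma length_2E:
  assumes "length us = 2"
  obtains u v where "us = [u, v]"
  using assms by (auto simp: numeral_2_eq_2 length_Suc_conv)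

lemma length_3E:
  assumes "length us = 3"
  obtains u v w where "us = [u, v, w]"
  using assms by (auto simp: numeral_3_eq_3 length_Suc_conv)

lemma d_H_1_in_cochains:
  assumes "f \<in> cochains 1"
  shows "d_H 1 f \<in> cochains 2"
proof -
  note f = cochains_1D[OF assms]
  have "d_H 1 f us = 0" if "length us \<noteq> 2" for us
    using that by (simp add: d_H_def)
  moreover have "Vector_Spaces.linear scaleM scaleA (\<lambda>x. d_H 1 f (us[i := x]))"
    if us: "length us = 2" and "i < 2" for us i
  proof -
    obtain u v where "us = [u, v]" by (rule length_2E[OF us])
    moreover have "i = 0 \<or> i = 1" using \<open>i < 2\<close> by auto
    ultimately show ?thesis
      unfolding Vector_Spaces.linear_iff
      by (elim disjE)
        (simp_all add: vector_space_axioms M.vector_space_axioms d_H_1[unfolded One_nat_def] f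
          star_simps lact_simps ract_simps scale_right_distrib scale_right_diff_distrib)
  qed
  moreover have "\<alpha> (d_H 1 f us) = d_H 1 f (map \<phi> us)" if us: "length us = 2" for us
  proof -
    obtain u v where "us = [u, v]" by (rule length_2E[OF us])
    then show ?thesis
      by (simp only: d_H_1 list.map)
        (simp add: alpha_simps alpha_lact alpha_ract f phi_star)
  qed
  ultimately show ?thesis
    unfolding cochains_def by blast
qed

text \<open>Write \<open>L\<close> and \<open>R\<close> for the two actions. Expanding both differentials gives terms with two
  actions, which cancel by the three module laws; \<open>\<alpha> f = f \<phi>\<close> supplies the twist by \<open>\<alpha>\<close> in the laws for
  \<open>L L\<close> and \<open>R R\<close>. The terms with one action on \<open>f(u * v)\<close> occur twice with opposite signs. The terms
  where \<open>f\<close> meets a triple product cancel by Hom-associativity of the product on \<open>M\<close>.\<close>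

lemma d_H_d_H_1:
  assumes "f \<in> cochains 1"
  shows "d_H 2 (d_H 1 f) = (\<lambda>_. 0)"
proof
  fix us :: "'m list"
  note f = cochains_1D[OF assms]
  show "d_H 2 (d_H 1 f) us = 0"
  proof (cases "length us = 3")
    case True
    then obtain u v w where "us = [u, v, w]" by (rule length_3E)
    then show ?thesis
      by (simp add: d_H_2 d_H_1[unfolded One_nat_def] lact_simps ract_simps lact_lact
          ract_ract lact_ract f star_hom_assoc)
  next
    case False
    then show ?thesis by (simp add: d_H_def)
  qed
qed

lemma coboundaries_2_subset_cocycles: "coboundaries 2 \<subseteq> cocycles 2"
  unfolding coboundaries_def cocycles_def
  using d_H_1_in_cochains d_H_d_H_1 by auto

lemma zero_in_coboundaries: "(\<lambda>_. 0) \<in> coboundaries n"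
  unfolding coboundaries_def by (rule image_eqI[where x = "\<lambda>_. 0"]) (simp_all add: d_H_zero zero_in_cochains)

lemma coboundaries_diff:
  assumes "f \<in> coboundaries n" "g \<in> coboundaries n"
  shows "(\<lambda>us. f us - g us) \<in> coboundaries n"
proof -
  obtain f' g' where "f' \<in> cochains (n - 1)" "g' \<in> cochains (n - 1)"
    "f = d_H (n - 1) f'" "g = d_H (n - 1) g'"
    using assms unfolding coboundaries_def by blast
  then show ?thesis
    unfolding coboundaries_def
    by (intro image_eqI[where x = "\<lambda>us. f' us - g' us"]) (simp_all add: cochains_diff d_H_diff)
qed

text \<open>Only a cocycle has a nonempty class, and the class of \<open>0\<close> contains \<open>0\<close>. So if the class of \<open>f\<close>
  is trivial, then \<open>f\<close> is cohomologous to \<open>0\<close>. Conversely, a coboundary is a cocycle, and subtracting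
  it does not change which functions differ from a given one by a coboundary.\<close>

lemma trivial_class_2_iff: "trivial_class 2 (cohomology_class 2 f) \<longleftrightarrow> f \<in> coboundaries 2"
proof
  have "(\<lambda>_. 0) \<in> cocycles 2"
    using zero_in_coboundaries coboundaries_2_subset_cocycles by blast
  then have "(\<lambda>_. 0) \<in> cohomology_class 2 (\<lambda>_. 0)"
    by (simp add: cohomology_class_def cohomologous_def zero_in_coboundaries)
  moreover assume "trivial_class 2 (cohomology_class 2 f)"
  ultimately have "(\<lambda>_. 0) \<in> cohomology_class 2 f"
    by (simp add: trivial_class_def)
  then show "f \<in> coboundaries 2"
    by (simp add: cohomology_class_def cohomologous_def)
next
  assume f: "f \<in> coboundaries 2"
  have "(\<lambda>us. f us - g us) \<in> coboundaries 2 \<longleftrightarrow> (\<lambda>us. 0 - g us) \<in> coboundaries 2" for g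
  proof
    assume "(\<lambda>us. f us - g us) \<in> coboundaries 2"
    from coboundaries_diff[OF this f] show "(\<lambda>us. 0 - g us) \<in> coboundaries 2" by simp
  next
    assume "(\<lambda>us. 0 - g us) \<in> coboundaries 2"
    from coboundaries_diff[OF f coboundaries_diff[OF zero_in_coboundaries this]]
    have "(\<lambda>us. f us - (0 - (0 - g us))) \<in> coboundaries 2" .
    then show "(\<lambda>us. f us - g us) \<in> coboundaries 2" by simp
  qed
  moreover have "f \<in> cocycles 2" "(\<lambda>_. 0) \<in> cocycles 2"
    using f zero_in_coboundaries coboundaries_2_subset_cocycles by blast+
  ultimately show "trivial_class 2 (cohomology_class 2 f)"
    by (auto simp: trivial_class_def cohomology_class_def cohomologous_def)
qed

section \<open>The deformation equation in degree n + 1\<close>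

lemma deformation_coeff_in_cochains:
  assumes "deformation n Ts" "i \<in> {1..n}"
  shows "Ts i \<in> cochains 1"
  using assms unfolding deformation_def by blast

text \<open>The sum over \<open>i\<close> of the brackets of \<open>T\<^sub>i\<close> with \<open>T\<^sub>j\<close>, \<open>j = n + 1 - i\<close>, counts the defect of each
  ordered pair \<open>(i, j)\<close> once directly and once through \<open>(j, i)\<close>; the factor \<open>1/2\<close> undoes this.\<close>

lemma obstruction_eq:
  assumes two: "(2::'k) \<noteq> 0" and "deformation n Ts"
  shows "obstruction n Ts [u, v] = (\<Sum>i = 1..n. Ts i [u] \<cdot> Ts (n + 1 - i) [v]
    - Ts i [l (Ts (n + 1 - i) [u]) v + r u (Ts (n + 1 - i) [v])])"
    (is "_ = (\<Sum>i = 1..n. ?D i (n + 1 - i))")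
proof -
  have "(\<Sum>i = 1..n. bracket (Ts i) (Ts (n + 1 - i)) [u, v])
      = (\<Sum>i = 1..n. - ?D i (n + 1 - i) - ?D (n + 1 - i) i)"
  proof (rule sum.cong[OF refl])
    fix i assume i: "i \<in> {1..n}"
    then have j: "n + 1 - i \<in> {1..n}" by auto
    show "bracket (Ts i) (Ts (n + 1 - i)) [u, v] = - ?D i (n + 1 - i) - ?D (n + 1 - i) i"
      using cochains_1D(1)[OF deformation_coeff_in_cochains[OF assms(2) i]]
        cochains_1D(1)[OF deformation_coeff_in_cochains[OF assms(2) j]]
      by (simp add: bracket_def)
  qed
  also have "\<dots> = - (\<Sum>i = 1..n. ?D i (n + 1 - i)) - (\<Sum>i = 1..n. ?D (n + 1 - i) i)"
    by (simp only: sum_subtractf sum_negf)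
  also have "(\<Sum>i = 1..n. ?D (n + 1 - i) i) = (\<Sum>i = 1..n. ?D i (n + 1 - i))"
    by (subst sum.atLeastAtMost_rev, rule sum.cong) auto
  also have "- (\<Sum>i = 1..n. ?D i (n + 1 - i)) - (\<Sum>i = 1..n. ?D i (n + 1 - i))
      = scaleA (- 2) (\<Sum>i = 1..n. ?D i (n + 1 - i))"
    using scale_left_distrib[of "- 1" "- 1" "\<Sum>i = 1..n. ?D i (n + 1 - i)"] by simp
  finally show ?thesis
    using two by (simp add: obstruction_def)
qed

lemma deformation_Suc_iff:
  assumes two: "(2::'k) \<noteq> 0" and def: "deformation n Ts" and S: "S \<in> cochains 1"
  shows "deformation (n + 1) (Ts(n + 1 := S)) \<longleftrightarrow>
    (\<forall>us. obstruction n Ts us = - d_H 1 S us)"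
proof -
  let ?Ts = "Ts(n + 1 := S)"
  let ?eq = "\<lambda>Ts k u v. (\<Sum>i\<le>k. Ts i [u] \<cdot> Ts (k - i) [v]) =
        (\<Sum>i\<le>k. Ts i [l (Ts (k - i) [u]) v + r u (Ts (k - i) [v])])"
  have T0: "Ts 0 [u] = T u" for u
    using def by (simp add: deformation_def T_cochain_def)
  have "?eq ?Ts k u v" if "k \<le> n" for k u v
  proof -
    have "?eq Ts k u v" using def that by (simp add: deformation_def)
    moreover have "?Ts i = Ts i" if "i \<le> k" for i
      using that \<open>k \<le> n\<close> by simp
    ultimately show ?thesis by simp
  qed
  moreover have "?Ts 0 = T_cochain" "\<forall>i\<in>{1..n + 1}. ?Ts i \<in> cochains 1"
    using def S by (auto simp: deformation_def)
  ultimately have "deformation (n + 1) ?Ts \<longleftrightarrow> (\<forall>u v. ?eq ?Ts (n + 1) u v)"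
    unfolding deformation_def by (auto simp: le_Suc_eq)
  also have "\<dots> \<longleftrightarrow> (\<forall>u v. obstruction n Ts [u, v] = - d_H 1 S [u, v])"
  proof -
    have split: "(\<Sum>i\<le>n + 1. F i) = F 0 + (\<Sum>i = 1..n. F i) + F (n + 1)" for F :: "nat \<Rightarrow> 'a"
      by (simp add: atMost_atLeast0 sum.atLeast_Suc_atMost)
    have "?eq ?Ts (n + 1) u v \<longleftrightarrow> obstruction n Ts [u, v] = - d_H 1 S [u, v]" for u v
    proof -
      let ?P = "\<Sum>i = 1..n. Ts i [u] \<cdot> Ts (n + 1 - i) [v]"
      let ?Q = "\<Sum>i = 1..n. Ts i [l (Ts (n + 1 - i) [u]) v + r u (Ts (n + 1 - i) [v])]"
      \<comment> \<open>The middle terms never refer to the new coefficient at index \<open>n + 1\<close>.\<close>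
      have Ts: "Suc n - i \<noteq> Suc n" if "Suc 0 \<le> i" for i
        using that by simp
      have "(\<Sum>i\<le>n + 1. ?Ts i [u] \<cdot> ?Ts (n + 1 - i) [v]) = T u \<cdot> S [v] + ?P + S [u] \<cdot> T v"
        unfolding split by (simp add: T0 Ts cong: sum.cong_simp)
      moreover have "(\<Sum>i\<le>n + 1. ?Ts i [l (?Ts (n + 1 - i) [u]) v + r u (?Ts (n + 1 - i) [v])])
          = T (l (S [u]) v) + T (r u (S [v])) + ?Q + S [star u v]"
        unfolding split by (simp add: T0 Ts T_simps star_def add.commute cong: sum.cong_simp)
      moreover have "obstruction n Ts [u, v] = ?P - ?Q"
        unfolding obstruction_eq[OF two def] by (rule sum_subtractf)
      moreover have "d_H 1 S [u, v] = T u \<cdot> S [v] - T (r u (S [v])) - S [star u v]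
          + (S [u] \<cdot> T v - T (l (S [u]) v))"
        by (simp only: d_H_1 lact_def ract_def)
      ultimately show ?thesis
        by (simp only:) (simp add: algebra_simps eq_neg_iff_add_eq_0 diff_eq_eq)
    qed
    then show ?thesis by simp
  qed
  also have "\<dots> \<longleftrightarrow> (\<forall>us. obstruction n Ts us = - d_H 1 S us)"
  proof -
    have "obstruction n Ts us = - d_H 1 S us" if "length us \<noteq> 2" for us
    proof -
      have "bracket f g us = 0" for f g
        using that by (auto simp: bracket_def split: list.splits)
      then show ?thesis using that by (simp add: obstruction_def d_H_def)
    qed
    then show ?thesis by (metis length_2E)
  qed
  finally show ?thesis .
qed

text \<open>The sign in \<open>\<Theta> = - d\<^sub>H S\<close> is absorbed by replacing \<open>S\<close> by \<open>- S\<close>.\<close>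

lemma extends_iff_obstruction_in_coboundaries:
  assumes two: "(2::'k) \<noteq> 0" and def: "deformation n Ts"
  shows "extends n Ts \<longleftrightarrow> obstruction n Ts \<in> coboundaries 2"
proof -
  have neg: "(\<lambda>us. - S us) \<in> cochains 1" "d_H 1 (\<lambda>us. - S us) = (\<lambda>us. - d_H 1 S us)"
    if "S \<in> cochains 1" for S
    using cochains_diff[OF zero_in_cochains that] d_H_diff[of 1 "\<lambda>_. 0" S]
    by (simp_all add: d_H_zero)
  have "extends n Ts \<longleftrightarrow> (\<exists>S\<in>cochains 1. obstruction n Ts = (\<lambda>us. - d_H 1 S us))"
    unfolding extends_def using deformation_Suc_iff[OF two def] by (auto simp: fun_eq_iff)
  also have "\<dots> \<longleftrightarrow> (\<exists>S\<in>cochains 1. obstruction n Ts = d_H 1 S)"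
  proof
    assume "\<exists>S\<in>cochains 1. obstruction n Ts = (\<lambda>us. - d_H 1 S us)"
    then show "\<exists>S\<in>cochains 1. obstruction n Ts = d_H 1 S" using neg by metis
  next
    assume "\<exists>S\<in>cochains 1. obstruction n Ts = d_H 1 S"
    then obtain S where S: "S \<in> cochains 1" "obstruction n Ts = d_H 1 S" by blast
    then have "obstruction n Ts = (\<lambda>us. - d_H 1 (\<lambda>us. - S us) us)"
      using neg(2)[OF S(1)] by (simp add: fun_eq_iff)
    then show "\<exists>S\<in>cochains 1. obstruction n Ts = (\<lambda>us. - d_H 1 S us)"
      using neg(1)[OF S(1)] by blast
  qed
  also have "\<dots> \<longleftrightarrow> obstruction n Ts \<in> coboundaries 2"
    by (auto simp: coboundaries_def)
  finally show ?thesis .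
qed

end

section \<open>Extendability and the obstruction class\<close>

theorem theorem4p22:
  fixes scaleA :: "'k::field \<Rightarrow> 'a::ab_group_add \<Rightarrow> 'a"
    and mult :: "'a \<Rightarrow> 'a \<Rightarrow> 'a"
    and \<alpha> :: "'a \<Rightarrow> 'a"
    and scaleM :: "'k \<Rightarrow> 'm::ab_group_add \<Rightarrow> 'm"
    and l :: "'a \<Rightarrow> 'm \<Rightarrow> 'm"
    and r :: "'m \<Rightarrow> 'a \<Rightarrow> 'm"
    and \<phi> :: "'m \<Rightarrow> 'm"
    and T :: "'m \<Rightarrow> 'a"
    and n :: nat
    and Ts :: "nat \<Rightarrow> 'm list \<Rightarrow> 'a"
  assumes "CHAR('k) \<noteq> 2"
    and "O_operator scaleA mult \<alpha> scaleM l r \<phi> T"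
    and "n \<ge> 1"
    and "O_operator.deformation scaleA mult \<alpha> scaleM l r \<phi> T n Ts"
  shows "O_operator.extends scaleA mult \<alpha> scaleM l r \<phi> T n Ts \<longleftrightarrow>
    O_operator.trivial_class scaleA mult \<alpha> scaleM l r \<phi> T 2
      (O_operator.obstruction_class scaleA mult \<alpha> scaleM l r \<phi> T n Ts)"
proof -
  interpret O_operator scaleA mult \<alpha> scaleM l r \<phi> T by (fact assms(2))
  have "extends n Ts \<longleftrightarrow> obstruction n Ts \<in> coboundaries 2"
    by (rule extends_iff_obstruction_in_coboundaries[OF
          two_neq_zero_if_CHAR_neq_2[OF assms(1)] assms(4)])
  also have "\<dots> \<longleftrightarrow> trivial_class 2 (obstruction_class n Ts)"
    by (simp only: obstruction_class_def trivial_class_2_iff)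
  finally show ?thesis .
qed

end
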